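(* Let $\alpha$ be a dotted composition. Then, in $\mathbf{sQSym}$, $$L_{\alpha}=\sum_{\beta\preceq\alpha}M_{\beta},\qquad M_{\alpha}=\sum_{\beta\preceq\alpha}(-1)^{\ell(\alpha)-\ell(\beta)}L_{\beta},\qquad \Delta(L_{\alpha})=\sum_{\beta\gamma=\alpha\ \text{or}\ \beta\odot\gamma=\alpha}L_{\beta}\otimes L_{\gamma},$$ where the last sum is over pairs of dotted compositions $(\beta,\gamma)$, with $\beta$ or $\gamma$ allowed to be empty in the case $\beta\gamma=\alpha$ ($L_\emptyset=1$), and with $\beta,\gamma$ nonempty and $\beta\odot\gamma$ defined in the case $\beta\odot\gamma=\alpha$.
   Context: Let $\mathbb N=\{1,2,\ldots\}$ and $\dot{\mathbb N}_0=\{\dot0,\dot1,\dot2,\ldots\}$ (dotted copies of the nonnegative integers). A dotted composition is a finite tuple $\alpha=(\alpha_1,\ldots,\alpha_k)$ with entries in $\mathbb N\cup\dot{\mathbb N}_0$; its length is $\ell(\alpha)=k$; its degree $|\alpha|$ is the sum of the numerical values of its entries plus the number of dotted entries. For entries not both dotted put $m\oplus n=m+n$ and $m\oplus\dot n=\dot m\oplus n=\dot r$ with $r=m+n$. The partial order $\preceq$ on dotted compositions is the reflexive-transitive closure of the relation: $\beta$ is obtained from $\alpha$ by replacing two consecutive entries $x,y$ of $\alpha$ that are not both dotted by the single entry $x\oplus y$ (then $\alpha\preceq\beta$). $\alpha\beta$ denotes concatenation. For $\alpha=(\alpha_1,\ldots,\alpha_r)$, $\beta=(\beta_1,\ldots,\beta_s)$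 nonempty with $\alpha_r,\beta_1$ not both dotted, $\alpha\odot\beta:=(\alpha_1,\ldots,\alpha_{r-1},\alpha_r\oplus\beta_1,\beta_2,\ldots,\beta_s)$. $\mathbf{sNSym}$, as an algebra, is the free associative unital $\mathbb Q$-algebra on generators $H_n$ ($n\in\mathbb N$) and $H_{\dot n}=\tilde H_n$ ($n\ge0$); $H_\alpha:=H_{\alpha_1}\cdots H_{\alpha_k}$, and the $H_\alpha$ form a basis, with $H_\alpha$ homogeneous of degree $|\alpha|$. The noncommutative Ribbon Schur functions in superspace $R_\alpha$ are defined recursively by $R_\alpha=H_\alpha-\sum_{\alpha\prec\beta}R_\beta$; they form a basis of $\mathbf{sNSym}$. $\mathbf{sQSym}$ (quasisymmetric functions in superspace) is the graded dual of $\mathbf{sNSym}$; its monomial basis $\{M_\alpha\}$ is the dual basis of $\{H_\alpha\}$ under the pairing $\langle M_\alpha,H_\beta\rangle=\delta_{\alpha\beta}$, and its coproduct $\Delta$ is dual to the product of $\mathbf{sNSym}$, i.e. $\langle \Delta(f),x\otimes y\rangle=\langle f,xy\rangle$ with $\langle f\otimes g,x\otimes y\rangle=\langle f,x\rangle\langle g,y\rangle$ (equivalently $\Delta(M_\alpha)=\sum_{\beta\gamma=\alpha}M_\beta\otimes M_\gamma$). The fundamental quasisymmetric functions in superspace $L_\alpha$ are the basis of $\mathbf{sQSym}$ dual to $\{R_\beta\}$: $\langle L_\alpha,R_\beta\rangle=\delta_{\alpha\beta}$. *)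

theory Defs
  imports Complex_Main "HOL-Library.Poly_Mapping"
begin

section \<open>Dotted compositions\<close>

text \<open>An entry is a numerical value together with a flag saying whether it is dotted.\<close>

typedef entry = "{(n :: nat, d :: bool). 1 \<le> n \<or> d}"
  by auto

setup_lifting type_definition_entry

lift_definition val :: "entry \<Rightarrow> nat" is fst .
lift_definition dotted :: "entry \<Rightarrow> bool" is snd .

text \<open>Only meaningful for entries that are not both dotted; every use below is guarded accordingly.\<close>

lift_definition eplus :: "entry \<Rightarrow> entry \<Rightarrow> entry"
  is "\<lambda>(m, c) (n, d). (m + n, c \<or> d)"
  by auto

type_synonym dcomp = "entry list"

definition degree :: "dcomp \<Rightarrow> nat" where
  "degree \<alpha> = sum_list (map val \<alpha>) + length (filter dotted \<alpha>)"

inductive merge :: "dcomp \<Rightarrow> dcomp \<Rightarrow> bool" where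
  "\<not> (dotted x \<and> dotted y) \<Longrightarrow> merge (\<alpha> @ [x, y] @ \<beta>) (\<alpha> @ [eplus x y] @ \<beta>)"

definition dle :: "dcomp \<Rightarrow> dcomp \<Rightarrow> bool" (infix "\<preceq>" 50) where
  "\<alpha> \<preceq> \<beta> \<longleftrightarrow> rtranclp merge \<alpha> \<beta>"

definition dless :: "dcomp \<Rightarrow> dcomp \<Rightarrow> bool" (infix "\<prec>" 50) where
  "\<alpha> \<prec> \<beta> \<longleftrightarrow> \<alpha> \<preceq> \<beta> \<and> \<alpha> \<noteq> \<beta>"

definition odot_defined :: "dcomp \<Rightarrow> dcomp \<Rightarrow> bool" where
  "odot_defined \<alpha> \<beta> \<longleftrightarrow>
     \<alpha> \<noteq> [] \<and> \<beta> \<noteq> [] \<and> \<not> (dotted (last \<alpha>) \<and> dotted (hd \<beta>))"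

definition odot :: "dcomp \<Rightarrow> dcomp \<Rightarrow> dcomp" where
  "odot \<alpha> \<beta> = butlast \<alpha> @ [eplus (last \<alpha>) (hd \<beta>)] @ tl \<beta>"

lemma merge_degree: "merge \<alpha> \<beta> \<Longrightarrow> degree \<alpha> = degree \<beta>"
proof (induction rule: merge.induct)
  case (1 x y \<alpha> \<beta>)
  have "val (eplus x y) = val x + val y" "dotted (eplus x y) = (dotted x \<or> dotted y)"
    by (transfer; auto)+
  with 1 show ?case
    by (auto simp: degree_def)
qed

lemma dle_degree: "\<alpha> \<preceq> \<beta> \<Longrightarrow> degree \<alpha> = degree \<beta>"
  unfolding dle_def by (induction rule: rtranclp_induct) (auto simp: merge_degree)

lemma dle_length: "\<alpha> \<preceq> \<beta> \<Longrightarrow> \<alpha> = \<beta> \<or> length \<beta> < length \<alpha>"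
  unfolding dle_def by (induction rule: rtranclp_induct) (auto elim!: merge.cases)

lemma finite_degree: "finite {\<alpha>. degree \<alpha> = n}"
proof -
  have "finite {x. val x \<le> n}"
  proof (rule inj_on_finite)
    show "inj_on Rep_entry {x. val x \<le> n}"
      by (simp add: inj_on_def Rep_entry_inject)
    show "Rep_entry ` {x. val x \<le> n} \<subseteq> {..n} \<times> UNIV"
      by (auto simp: val.rep_eq mem_Times_iff dest!: arg_cong[where f = fst])
  qed simp
  then have "finite {\<alpha>. set \<alpha> \<subseteq> {x. val x \<le> n} \<and> length \<alpha> \<le> n}"
    by (rule finite_lists_length_le)
  moreover have "length \<alpha> \<le> degree \<alpha> \<and> (\<forall>x\<in>set \<alpha>. val x \<le> degree \<alpha>)" for \<alpha>
  proof (induction \<alpha>)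
    case (Cons x \<alpha>)
    have "1 \<le> val x \<or> dotted x"
      by transfer auto
    with Cons show ?case
      by (force simp: degree_def)
  qed (simp add: degree_def)
  ultimately show ?thesis
    by (elim rev_finite_subset) auto
qed

text \<open>All the sums below over intervals of the order are therefore finite.\<close>

lemma finite_dle: "finite {\<beta>. \<beta> \<preceq> \<alpha>}" "finite {\<beta>. \<alpha> \<preceq> \<beta>}" "finite {\<beta>. \<alpha> \<prec> \<beta>}"
  by (rule finite_subset[OF _ finite_degree[of "degree \<alpha>"]]; auto simp: dless_def dest: dle_degree)+

section \<open>The algebra sNSym\<close>

text \<open>
  Finitely supported functions on a monoid, with the convolution product of
  \<^theory>\<open>HOL-Library.Poly_Mapping\<close>, form the monoid algebra. For lists under
  concatenation (the free monoid) this is the free associative unital algebra.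
\<close>

instantiation list :: (type) monoid_add
begin

definition zero_list :: "'a list" where "zero_list = []"
definition plus_list :: "'a list \<Rightarrow> 'a list \<Rightarrow> 'a list" where "plus_list = (@)"

instance
  by standard (auto simp: zero_list_def plus_list_def)

end

type_synonym snsym = "dcomp \<Rightarrow>\<^sub>0 rat"

lift_definition qscale :: "rat \<Rightarrow> ('a \<Rightarrow>\<^sub>0 rat) \<Rightarrow> ('a \<Rightarrow>\<^sub>0 rat)"
  is "\<lambda>c p k. c * p k"
  by (erule rev_finite_subset) auto

lemma lookup_qscale [simp]: "Poly_Mapping.lookup (qscale c p) k = c * Poly_Mapping.lookup p k"
  by (simp add: qscale.rep_eq)

global_interpretation qvs: vector_space qscale
  by unfold_locales (auto intro!: poly_mapping_eqI simp: lookup_add algebra_simps)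

definition Hgen :: "entry \<Rightarrow> snsym" where
  "Hgen x = Poly_Mapping.single [x] 1"

definition H :: "dcomp \<Rightarrow> snsym" where
  "H \<alpha> = prod_list (map Hgen \<alpha>)"

definition snsym_component :: "nat \<Rightarrow> snsym set" where
  "snsym_component n = qvs.span {H \<alpha> |\<alpha>. degree \<alpha> = n}"

function R :: "dcomp \<Rightarrow> snsym" where
  "R \<alpha> = H \<alpha> - (\<Sum>\<beta> | \<alpha> \<prec> \<beta>. R \<beta>)"
  by auto
termination
  by (relation "measure length") (auto simp: dless_def dest: dle_length)

declare R.simps [simp del]

section \<open>The graded dual sQSym\<close>

text \<open>
  The graded dual is the space of linear functionals that vanish on all but finitely many
  homogeneous components.
\<close>

typedef sqsym = "{f :: snsym \<Rightarrow> rat. Vector_Spaces.linear qscale (*) f \<and>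
    finite {n. \<exists>x\<in>snsym_component n. f x \<noteq> 0}}"
  morphisms pairing Abs_sqsym
proof (intro exI CollectI conjI)
  show "Vector_Spaces.linear qscale (*) (\<lambda>_. 0 :: rat)"
    by unfold_locales (auto simp: algebra_simps)
qed auto

setup_lifting type_definition_sqsym

lemma linear_qscale_iff:
  "Vector_Spaces.linear qscale ((*) :: rat \<Rightarrow> rat \<Rightarrow> rat) f \<longleftrightarrow>
     (\<forall>x y. f (x + y) = f x + f y) \<and> (\<forall>c x. f (qscale c x) = c * f x)"
proof
  assume "Vector_Spaces.linear qscale ((*) :: rat \<Rightarrow> rat \<Rightarrow> rat) f"
  then interpret Vector_Spaces.linear qscale "(*) :: rat \<Rightarrow> rat \<Rightarrow> rat" f .
  show "(\<forall>x y. f (x + y) = f x + f y) \<and> (\<forall>c x. f (qscale c x) = c * f x)"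
    by (simp add: add scale)
qed (unfold_locales, auto simp: algebra_simps)

instantiation sqsym :: ab_group_add
begin

lift_definition zero_sqsym :: sqsym is "\<lambda>_. 0"
  by (simp add: linear_qscale_iff)

lift_definition plus_sqsym :: "sqsym \<Rightarrow> sqsym \<Rightarrow> sqsym" is "\<lambda>f g x. f x + g x"
proof (intro conjI, goal_cases)
  case (2 f g)
  then have "finite ({n. \<exists>x\<in>snsym_component n. f x \<noteq> 0} \<union> {n. \<exists>x\<in>snsym_component n. g x \<noteq> 0})"
    by simp
  then show ?case
    by (rule rev_finite_subset) auto
qed (auto simp: linear_qscale_iff algebra_simps)

lift_definition uminus_sqsym :: "sqsym \<Rightarrow> sqsym" is "\<lambda>f x. - f x"
  by (simp add: linear_qscale_iff)

definition minus_sqsym :: "sqsym \<Rightarrow> sqsym \<Rightarrow> sqsym" where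
  "minus_sqsym f g = f + - g"

instance
  by standard (unfold minus_sqsym_def, (transfer; force simp: algebra_simps)+)

end

lift_definition scale_sqsym :: "rat \<Rightarrow> sqsym \<Rightarrow> sqsym" is "\<lambda>c f x. c * f x"
proof (intro conjI, goal_cases)
  case (2 c f)
  then show ?case
    by (elim conjE) (erule rev_finite_subset, auto)
qed (auto simp: linear_qscale_iff algebra_simps)

definition dual_basis :: "(dcomp \<Rightarrow> snsym) \<Rightarrow> dcomp \<Rightarrow> sqsym" where
  "dual_basis B \<alpha> = (THE f. \<forall>\<beta>. pairing f (B \<beta>) = (if \<alpha> = \<beta> then 1 else 0))"

definition M :: "dcomp \<Rightarrow> sqsym" where
  "M = dual_basis H"

definition L :: "dcomp \<Rightarrow> sqsym" where
  "L = dual_basis R"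

section \<open>The tensor square of sQSym and the coproduct\<close>

text \<open>
  The tensor square is the vector space on the set of all pairs, modulo the relations
  of bilinearity.
\<close>

abbreviation pure :: "sqsym \<Rightarrow> sqsym \<Rightarrow> (sqsym \<times> sqsym \<Rightarrow>\<^sub>0 rat)" where
  "pure f g \<equiv> Poly_Mapping.single (f, g) 1"

definition tensor_relators :: "(sqsym \<times> sqsym \<Rightarrow>\<^sub>0 rat) set" where
  "tensor_relators =
     {pure (f + f') g - pure f g - pure f' g |f f' g. True} \<union>
     {pure f (g + g') - pure f g - pure f g' |f g g'. True} \<union>
     {pure (scale_sqsym c f) g - qscale c (pure f g) |c f g. True} \<union>
     {pure f (scale_sqsym c g) - qscale c (pure f g) |c f g. True}"

definition tensor_eq :: "(sqsym \<times> sqsym \<Rightarrow>\<^sub>0 rat) \<Rightarrow> (sqsym \<times> sqsym \<Rightarrow>\<^sub>0 rat) \<Rightarrow> bool" where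
  "tensor_eq p q \<longleftrightarrow> p - q \<in> qvs.span tensor_relators"

quotient_type sqsym2 = "sqsym \<times> sqsym \<Rightarrow>\<^sub>0 rat" / tensor_eq
proof (rule equivpI)
  show "reflp tensor_eq"
    by (simp add: reflp_def tensor_eq_def qvs.span_zero)
  show "symp tensor_eq"
    by (auto simp: symp_def tensor_eq_def dest: qvs.span_neg)
  show "transp tensor_eq"
    by (auto simp: transp_def tensor_eq_def dest: qvs.span_add)
qed

instantiation sqsym2 :: ab_group_add
begin

lift_definition zero_sqsym2 :: sqsym2 is 0 .

lift_definition plus_sqsym2 :: "sqsym2 \<Rightarrow> sqsym2 \<Rightarrow> sqsym2" is "(+)"
  unfolding tensor_eq_def by (drule (1) qvs.span_add) (simp add: algebra_simps)

lift_definition uminus_sqsym2 :: "sqsym2 \<Rightarrow> sqsym2" is uminus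
  unfolding tensor_eq_def by (drule qvs.span_neg) (simp add: algebra_simps)

definition minus_sqsym2 :: "sqsym2 \<Rightarrow> sqsym2 \<Rightarrow> sqsym2" where
  "minus_sqsym2 s t = s + - t"

instance
  by standard
    (unfold minus_sqsym2_def, (transfer; simp add: tensor_eq_def qvs.span_zero algebra_simps)+)

end

lift_definition tensor :: "sqsym \<Rightarrow> sqsym \<Rightarrow> sqsym2" (infixr "\<otimes>" 75) is pure .

text \<open>
  The pairing of an element of the tensor square with a pure tensor of x and y in sNSym,
  obtained by linear extension in the first argument. Pure tensors determine it completely.
\<close>

definition pre_pairing2 :: "(sqsym \<times> sqsym \<Rightarrow>\<^sub>0 rat) \<Rightarrow> snsym \<Rightarrow> snsym \<Rightarrow> rat" where
  "pre_pairing2 p x y =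
     (\<Sum>(f, g)\<in>Poly_Mapping.keys p. Poly_Mapping.lookup p (f, g) * (pairing f x * pairing g y))"

lemma pre_pairing2_superset:
  assumes "finite A" "Poly_Mapping.keys p \<subseteq> A"
  shows "pre_pairing2 p x y =
     (\<Sum>(f, g)\<in>A. Poly_Mapping.lookup p (f, g) * (pairing f x * pairing g y))"
  unfolding pre_pairing2_def using assms
  by (intro sum.mono_neutral_left) (auto simp: in_keys_iff)

lemma pre_pairing2_add: "pre_pairing2 (p + q) x y = pre_pairing2 p x y + pre_pairing2 q x y"
proof -
  let ?A = "Poly_Mapping.keys p \<union> Poly_Mapping.keys q"
  have "finite ?A" "Poly_Mapping.keys (p + q) \<subseteq> ?A"
    by (auto dest!: subsetD[OF Poly_Mapping.keys_add])
  then show ?thesis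
    by (simp add: pre_pairing2_superset[of ?A] lookup_add sum.distrib[symmetric]
        case_prod_unfold algebra_simps)
qed

lemma pre_pairing2_scale: "pre_pairing2 (qscale c p) x y = c * pre_pairing2 p x y"
proof -
  have "Poly_Mapping.keys (qscale c p) \<subseteq> Poly_Mapping.keys p"
    by (auto simp: in_keys_iff)
  then show ?thesis
    by (simp add: pre_pairing2_superset[of "Poly_Mapping.keys p"] sum_distrib_left
        case_prod_unfold algebra_simps)
qed

lemma pre_pairing2_diff: "pre_pairing2 (p - q) x y = pre_pairing2 p x y - pre_pairing2 q x y"
  using pre_pairing2_add[of "p - q" q x y] by simp

lemma pre_pairing2_pure: "pre_pairing2 (pure f g) x y = pairing f x * pairing g y"
  by (simp add: pre_pairing2_def)

lemma pre_pairing2_relators: "p \<in> qvs.span tensor_relators \<Longrightarrow> pre_pairing2 p x y = 0"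
proof (induction rule: qvs.span_induct_alt)
  case base
  show ?case by (simp add: pre_pairing2_def)
next
  case (step c p q)
  from step(1) have "pre_pairing2 p x y = 0"
    unfolding tensor_relators_def
    by (elim UnE CollectE exE conjE; hypsubst)
      (simp_all only: pre_pairing2_diff pre_pairing2_scale pre_pairing2_pure
        plus_sqsym.rep_eq scale_sqsym.rep_eq, simp_all add: algebra_simps)
  with step show ?case
    by (simp add: pre_pairing2_add pre_pairing2_scale)
qed

lift_definition pairing2 :: "sqsym2 \<Rightarrow> snsym \<Rightarrow> snsym \<Rightarrow> rat" is pre_pairing2
  unfolding tensor_eq_def fun_eq_iff
  by (metis pre_pairing2_relators pre_pairing2_diff right_minus_eq)

lemma pairing2_tensor: "pairing2 (f \<otimes> g) x y = pairing f x * pairing g y"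
  by transfer (simp add: pre_pairing2_pure)

definition coproduct :: "sqsym \<Rightarrow> sqsym2" where
  "coproduct f = (THE t. \<forall>x y. pairing2 t x y = pairing f (x * y))"

end

theory Submission
  imports Defs
begin

text \<open>
  The three formulas are dual to statements about \<open>H\<close> and \<open>R\<close> in the free algebra. The
  functional \<open>M \<alpha>\<close> reads off the coefficient of \<open>H \<alpha>\<close>, and an element of the graded dual is
  determined by its values on either of the two families. Hence:

  \<^item> the first formula is dual to \<open>H \<alpha> = (\<Sum>\<beta> | \<alpha> \<preceq> \<beta>. R \<beta>)\<close>, which is the recursion defining \<open>R\<close>;

  \<^item> the second is dual to the expansion of \<open>R \<gamma>\<close> in the \<open>H \<alpha>\<close> with \<open>\<gamma> \<preceq> \<alpha>\<close>, with alternating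
    signs (\<open>lookup_R\<close>);

  \<^item> the third is dual to the product rule: \<open>R \<beta> * R \<gamma>\<close> is \<open>R (\<beta> @ \<gamma>)\<close>, plus \<open>R (odot \<beta> \<gamma>)\<close> if this
    is defined (\<open>R_mult\<close>).

  The combinatorial content is how the compositions above \<open>x # \<gamma>\<close> arise from those above \<open>\<gamma>\<close>.
  For each \<open>\<beta>\<close> above \<open>\<gamma>\<close>, the entry \<open>x\<close> is either kept in front or added to the first entry of
  \<open>\<beta>\<close>, and no composition arises twice (\<open>dle_Cons_iff_final\<close>, \<open>odot_not_dle_Cons\<close>,
  \<open>inj_on_odot\<close>). This gives \<open>H [x] * H \<gamma>\<close> as a sum over \<open>\<beta>\<close>, from which the product \<open>H [x] * R \<gamma>\<close>
  follows by cancelling the terms with \<open>\<gamma> \<prec> \<beta>\<close>. That product is a recursion for \<open>R (x # \<gamma>)\<close>;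
  with the associativity of \<open>odot\<close> it yields the product rule, and with a second description of
  the same up-set (\<open>dle_Cons_iff_initial\<close>) it yields the signs.

  For the coproduct one also has to know that an element of the tensor square is determined by
  its pairings. It can be written as a finite sum of tensors \<open>g \<gamma> \<otimes> M \<gamma>\<close>, and pairing the second
  factor with \<open>H \<gamma>\<close> isolates \<open>g \<gamma>\<close>.
\<close>

section \<open>The order and the partial operation \<open>odot\<close>\<close>

lemma val_eplus [simp]: "val (eplus x y) = val x + val y"
  and dotted_eplus [simp]: "dotted (eplus x y) \<longleftrightarrow> dotted x \<or> dotted y"
  by (transfer; auto)+

lemma entry_eqI: "val x = val y \<Longrightarrow> dotted x = dotted y \<Longrightarrow> x = y"
  by transfer (auto simp: prod_eq_iff)

lemma eplus_assoc: "eplus (eplus x y) z = eplus x (eplus y z)"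
  by (rule entry_eqI) auto

lemma degree_append: "degree (\<alpha> @ \<beta>) = degree \<alpha> + degree \<beta>"
  by (simp add: degree_def)

lemma degree_single_pos: "0 < degree [x]"
proof -
  have "1 \<le> val x \<or> dotted x"
    by transfer auto
  then show ?thesis
    by (auto simp: degree_def)
qed

lemma degree_eplus:
  "\<not> (dotted x \<and> dotted y) \<Longrightarrow> degree [eplus x y] = degree [x] + degree [y]"
  by (auto simp: degree_def)

lemma odot_defined_Nil [simp]: "\<not> odot_defined [] \<gamma>" "\<not> odot_defined \<beta> []"
  by (auto simp: odot_defined_def)

lemma odot_defined_Cons [simp]: "odot_defined [x] (z # \<delta>) \<longleftrightarrow> \<not> (dotted x \<and> dotted z)"
  by (auto simp: odot_defined_def)

lemma odot_Cons [simp]: "odot [x] (z # \<delta>) = eplus x z # \<delta>"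
  by (simp add: odot_def)

lemma odot_definedE:
  assumes "odot_defined [x] \<gamma>"
  obtains z \<delta> where "\<gamma> = z # \<delta>" "\<not> (dotted x \<and> dotted z)"
  using assms by (cases \<gamma>) auto

lemma merge_append_odot: "odot_defined \<beta> \<gamma> \<Longrightarrow> merge (\<beta> @ \<gamma>) (odot \<beta> \<gamma>)"
  using merge.intros[of "last \<beta>" "hd \<gamma>" "butlast \<beta>" "tl \<gamma>"]
  by (cases \<beta> rule: rev_cases; cases \<gamma>) (auto simp: odot_defined_def odot_def)

lemma degree_odot: "odot_defined \<beta> \<gamma> \<Longrightarrow> degree (odot \<beta> \<gamma>) = degree \<beta> + degree \<gamma>"
  using merge_degree[OF merge_append_odot] by (simp add: degree_append)

lemma merge_Cons_iff:
  "merge (x # \<gamma>) \<alpha> \<longleftrightarrow>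
     (\<exists>\<gamma>'. \<alpha> = x # \<gamma>' \<and> merge \<gamma> \<gamma>') \<or> odot_defined [x] \<gamma> \<and> \<alpha> = odot [x] \<gamma>"
proof
  assume "merge (x # \<gamma>) \<alpha>"
  then obtain u v \<mu> \<nu> where *: "x # \<gamma> = \<mu> @ [u, v] @ \<nu>" "\<alpha> = \<mu> @ [eplus u v] @ \<nu>"
    "\<not> (dotted u \<and> dotted v)"
    by (rule merge.cases) simp
  then show "(\<exists>\<gamma>'. \<alpha> = x # \<gamma>' \<and> merge \<gamma> \<gamma>') \<or> odot_defined [x] \<gamma> \<and> \<alpha> = odot [x] \<gamma>"
  proof (cases \<mu>)
    case (Cons m \<mu>')
    with * have "\<alpha> = x # \<mu>' @ [eplus u v] @ \<nu>" "\<gamma> = \<mu>' @ [u, v] @ \<nu>"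
      by auto
    with *(3) show ?thesis
      using merge.intros by blast
  qed auto
next
  assume "(\<exists>\<gamma>'. \<alpha> = x # \<gamma>' \<and> merge \<gamma> \<gamma>') \<or> odot_defined [x] \<gamma> \<and> \<alpha> = odot [x] \<gamma>"
  then show "merge (x # \<gamma>) \<alpha>"
  proof (elim disjE exE conjE)
    fix \<gamma>' assume "\<alpha> = x # \<gamma>'" and "merge \<gamma> \<gamma>'"
    from this(2) show ?thesis
    proof (cases rule: merge.cases)
      case (1 u v \<mu> \<nu>)
      then show ?thesis
        using merge.intros[of u v "x # \<mu>" \<nu>] \<open>\<alpha> = x # \<gamma>'\<close> by simp
    qed
  qed (use merge_append_odot[of "[x]" \<gamma>] in simp)
qed

text \<open>
  If \<open>x\<close> has been absorbed into the first entry of \<open>\<gamma>\<close>, merging that entry with its right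
  neighbour is, by associativity of \<open>eplus\<close>, the same as merging first within \<open>\<gamma>\<close> and absorbing
  \<open>x\<close> afterwards.
\<close>

lemma merge_odot_iff:
  assumes "odot_defined [x] \<gamma>"
  shows "merge (odot [x] \<gamma>) \<alpha> \<longleftrightarrow>
    (\<exists>\<gamma>'. merge \<gamma> \<gamma>' \<and> odot_defined [x] \<gamma>' \<and> \<alpha> = odot [x] \<gamma>')"
proof -
  obtain z \<delta> where [simp]: "\<gamma> = z # \<delta>" and nd: "\<not> (dotted x \<and> dotted z)"
    using assms by (rule odot_definedE)
  show ?thesis
  proof (cases \<delta>)
    case Nil
    then show ?thesis
      by (auto simp: merge_Cons_iff elim: merge.cases)
  next
    case (Cons w \<epsilon>)
    with nd show ?thesis
      by (auto simp: merge_Cons_iff[of "eplus x z"] merge_Cons_iff[of z] eplus_assoc)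
  qed
qed

text \<open>
  Merging never removes a dot, so a head that is undotted after a merge was undotted before.
\<close>

lemma odot_defined_merge: "merge \<gamma> \<gamma>' \<Longrightarrow> odot_defined [x] \<gamma>' \<Longrightarrow> odot_defined [x] \<gamma>"
  by (cases \<gamma>; cases "tl \<gamma>") (auto simp: merge_Cons_iff elim: merge.cases)

lemma dle_refl [simp]: "\<alpha> \<preceq> \<alpha>"
  by (simp add: dle_def)

lemma dle_trans: "\<alpha> \<preceq> \<beta> \<Longrightarrow> \<beta> \<preceq> \<gamma> \<Longrightarrow> \<alpha> \<preceq> \<gamma>"
  unfolding dle_def by (rule rtranclp_trans)

lemma merge_imp_dle: "merge \<alpha> \<beta> \<Longrightarrow> \<alpha> \<preceq> \<beta>"
  unfolding dle_def by blast

lemma dle_Cons_mono: "\<gamma> \<preceq> \<delta> \<Longrightarrow> x # \<gamma> \<preceq> x # \<delta>"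
  unfolding dle_def
  by (induction rule: rtranclp_induct) (auto intro: rtranclp.rtrancl_into_rtrancl simp: merge_Cons_iff)

lemma dle_odot_mono:
  assumes "\<gamma> \<preceq> \<delta>" "odot_defined [x] \<delta>"
  shows "odot_defined [x] \<gamma> \<and> odot [x] \<gamma> \<preceq> odot [x] \<delta>"
  using assms unfolding dle_def
proof (induction rule: converse_rtranclp_induct)
  case (step \<gamma> \<gamma>')
  then show ?case
    by (meson converse_rtranclp_into_rtranclp merge_odot_iff odot_defined_merge)
qed auto

text \<open>
  The absorption of \<open>x\<close> can be postponed until all merges within \<open>\<gamma>\<close> have been carried out.
\<close>

lemma dle_Cons_iff_final:
  "x # \<gamma> \<preceq> \<alpha> \<longleftrightarrow>
     (\<exists>\<beta>. \<gamma> \<preceq> \<beta> \<and> \<alpha> = x # \<beta>) \<or> (\<exists>\<beta>. \<gamma> \<preceq> \<beta> \<and> odot_defined [x] \<beta> \<and> \<alpha> = odot [x] \<beta>)"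
proof
  assume "x # \<gamma> \<preceq> \<alpha>"
  then show "(\<exists>\<beta>. \<gamma> \<preceq> \<beta> \<and> \<alpha> = x # \<beta>) \<or> (\<exists>\<beta>. \<gamma> \<preceq> \<beta> \<and> odot_defined [x] \<beta> \<and> \<alpha> = odot [x] \<beta>)"
    unfolding dle_def[of "x # \<gamma>"]
  proof (induction rule: rtranclp_induct)
    case (step \<alpha> \<alpha>')
    from step.IH show ?case
    proof (elim disjE exE conjE)
      fix \<beta> assume "\<gamma> \<preceq> \<beta>" "\<alpha> = x # \<beta>"
      then show ?thesis
        using step.hyps(2) by (auto simp: merge_Cons_iff dest: merge_imp_dle intro: dle_trans)
    next
      fix \<beta> assume "\<gamma> \<preceq> \<beta>" "odot_defined [x] \<beta>" "\<alpha> = odot [x] \<beta>"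
      then show ?thesis
        using step.hyps(2) by (auto simp: merge_odot_iff dest: merge_imp_dle intro: dle_trans)
    qed
  qed auto
next
  assume "(\<exists>\<beta>. \<gamma> \<preceq> \<beta> \<and> \<alpha> = x # \<beta>) \<or> (\<exists>\<beta>. \<gamma> \<preceq> \<beta> \<and> odot_defined [x] \<beta> \<and> \<alpha> = odot [x] \<beta>)"
  then show "x # \<gamma> \<preceq> \<alpha>"
  proof (elim disjE exE conjE)
    fix \<beta> assume "\<gamma> \<preceq> \<beta>" "odot_defined [x] \<beta>" "\<alpha> = odot [x] \<beta>"
    then show ?thesis
      using merge_append_odot[of "[x]" \<beta>] dle_Cons_mono[of \<gamma> \<beta> x]
      by (auto dest: merge_imp_dle intro: dle_trans)
  qed (auto intro: dle_Cons_mono)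
qed

text \<open>
  Conversely, the absorption of \<open>x\<close> can be made the first step. In this form the second
  alternative is an up-set again, as needed for recursion on \<open>R\<close>.
\<close>

lemma dle_Cons_iff_initial:
  "x # \<gamma> \<preceq> \<alpha> \<longleftrightarrow>
     (\<exists>\<beta>. \<gamma> \<preceq> \<beta> \<and> \<alpha> = x # \<beta>) \<or> odot_defined [x] \<gamma> \<and> odot [x] \<gamma> \<preceq> \<alpha>"
  (is "?l \<longleftrightarrow> ?r")
proof
  assume ?l
  then show ?r
    unfolding dle_Cons_iff_final using dle_odot_mono by blast
next
  assume ?r
  then show ?l
    using merge_append_odot[of "[x]" \<gamma>]
    by (auto intro: dle_Cons_mono dest: merge_imp_dle intro: dle_trans)
qed

lemma degree_hd_mono: "z # \<delta> \<preceq> w # \<epsilon> \<Longrightarrow> degree [z] \<le> degree [w]"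
  by (auto simp: dle_Cons_iff_final elim!: odot_definedE) (auto simp: degree_def split: if_splits)

text \<open>
  The two alternatives exclude each other: an entry has positive degree, so absorption strictly
  raises the degree of the head, and later merges cannot lower it.
\<close>

lemma odot_not_dle_Cons:
  assumes "odot_defined [x] \<gamma>"
  shows "\<not> odot [x] \<gamma> \<preceq> x # \<beta>"
  using assms
proof (rule odot_definedE)
  fix z \<delta> assume "\<gamma> = z # \<delta>" "\<not> (dotted x \<and> dotted z)"
  then show ?thesis
    using degree_hd_mono[of "eplus x z" \<delta> x \<beta>] degree_single_pos[of z]
    by (auto simp: degree_eplus)
qed

text \<open>
  Given \<open>x\<close>, the dot on \<open>eplus x z\<close> determines the one on \<open>z\<close>: if \<open>x\<close> is dotted then \<open>z\<close> is not,
  and otherwise both dots agree.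
\<close>

lemma inj_on_odot: "inj_on (odot [x]) {\<beta>. odot_defined [x] \<beta>}"
proof (rule inj_onI, clarsimp elim!: odot_definedE)
  fix y z
  assume nd: "dotted x \<longrightarrow> \<not> dotted y" "dotted x \<longrightarrow> \<not> dotted z" and eq: "eplus x y = eplus x z"
  have "val y = val z" "dotted y = dotted z"
    using arg_cong[OF eq, of val] arg_cong[OF eq, of dotted] nd by auto
  then show "y = z"
    by (rule entry_eqI)
qed

lemma odot_append:
  assumes "\<beta> \<noteq> []"
  shows "odot_defined \<alpha> (\<beta> @ \<gamma>) \<longleftrightarrow> odot_defined \<alpha> \<beta>"
    and "odot \<alpha> (\<beta> @ \<gamma>) = odot \<alpha> \<beta> @ \<gamma>"
  using assms by (auto simp: odot_defined_def odot_def)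

lemma append_odot:
  assumes "\<beta> \<noteq> []"
  shows "odot_defined (\<alpha> @ \<beta>) \<gamma> \<longleftrightarrow> odot_defined \<beta> \<gamma>"
    and "odot (\<alpha> @ \<beta>) \<gamma> = \<alpha> @ odot \<beta> \<gamma>"
  using assms by (auto simp: odot_defined_def odot_def butlast_append)

text \<open>
  If \<open>\<beta>\<close> has a single entry, both sides of the equivalence say that at most one of the three
  entries to be added is dotted.
\<close>

lemma odot_assoc:
  assumes "\<beta> \<noteq> []"
  shows "odot_defined \<beta> \<gamma> \<and> odot_defined [x] (odot \<beta> \<gamma>) \<longleftrightarrow>
      odot_defined [x] \<beta> \<and> odot_defined (odot [x] \<beta>) \<gamma>"
    and "odot [x] (odot \<beta> \<gamma>) = odot (odot [x] \<beta>) \<gamma>"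
proof -
  obtain y \<delta> where [simp]: "\<beta> = y # \<delta>"
    using assms by (cases \<beta>) auto
  show "odot_defined \<beta> \<gamma> \<and> odot_defined [x] (odot \<beta> \<gamma>) \<longleftrightarrow>
      odot_defined [x] \<beta> \<and> odot_defined (odot [x] \<beta>) \<gamma>"
    by (cases \<delta>) (auto simp: odot_defined_def odot_def)
  show "odot [x] (odot \<beta> \<gamma>) = odot (odot [x] \<beta>) \<gamma>"
    by (cases \<delta>) (auto simp: odot_def eplus_assoc)
qed

section \<open>Ribbon Schur functions\<close>

lemma H_eq_single: "H \<alpha> = Poly_Mapping.single \<alpha> 1"
proof (induction \<alpha>)
  case Nil
  show ?case
    using single_one[where 'a = dcomp and 'b = rat] by (simp add: H_def zero_list_def)
next
  case (Cons x \<alpha>)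
  have "H (x # \<alpha>) = Hgen x * H \<alpha>"
    by (simp add: H_def)
  with Cons show ?case
    by (simp add: Hgen_def mult_single plus_list_def)
qed

lemma H_Nil [simp]: "H [] = 1"
  by (simp add: H_def)

lemma H_mult: "H \<alpha> * H \<beta> = H (\<alpha> @ \<beta>)"
  by (simp add: H_eq_single mult_single plus_list_def)

lemma H_eq_sum_R: "H \<alpha> = (\<Sum>\<beta> | \<alpha> \<preceq> \<beta>. R \<beta>)"
proof -
  have "{\<beta>. \<alpha> \<preceq> \<beta>} = insert \<alpha> {\<beta>. \<alpha> \<prec> \<beta>}" "\<alpha> \<notin> {\<beta>. \<alpha> \<prec> \<beta>}"
    by (auto simp: dless_def)
  then have "(\<Sum>\<beta> | \<alpha> \<preceq> \<beta>. R \<beta>) = R \<alpha> + (\<Sum>\<beta> | \<alpha> \<prec> \<beta>. R \<beta>)"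
    by (simp add: finite_dle)
  then show ?thesis
    using R.simps[of \<alpha>] by simp
qed

text \<open>
  Expand \<open>H [x] * H \<gamma> = H (x # \<gamma>)\<close> in the ribbon functions on both sides. By the description of
  the compositions above \<open>x # \<gamma>\<close>, the identity holds after summation over all \<open>\<beta>\<close> with
  \<open>\<gamma> \<preceq> \<beta>\<close>; the terms with \<open>\<gamma> \<prec> \<beta>\<close> cancel by induction, as these \<open>\<beta>\<close> are shorter.
\<close>

lemma H_single_mult_R:
  "H [x] * R \<gamma> = R (x # \<gamma>) + (if odot_defined [x] \<gamma> then R (odot [x] \<gamma>) else 0)"
proof (induction \<gamma> rule: measure_induct_rule[of length])
  case (less \<gamma>)
  \<comment> \<open>the right-hand side of the claim, as a function of the composition\<close>
  define T where "T \<beta> = R (x # \<beta>) + (if odot_defined [x] \<beta> then R (odot [x] \<beta>) else 0)" for \<beta>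
  let ?U = "{\<beta>. \<gamma> \<preceq> \<beta>}" and ?D = "{\<beta>. \<gamma> \<preceq> \<beta> \<and> odot_defined [x] \<beta>}"
  have up: "{\<beta>. x # \<gamma> \<preceq> \<beta>} = Cons x ` ?U \<union> odot [x] ` ?D"
    by (auto simp: dle_Cons_iff_final)
  have "Cons x ` ?U \<inter> odot [x] ` ?D = {}"
    using odot_not_dle_Cons[of x] dle_refl by (auto simp del: dle_refl) metis
  moreover have "finite ?D"
    by (rule finite_subset[OF _ finite_dle(2)[of \<gamma>]]) auto
  ultimately have "H (x # \<gamma>) = sum R (Cons x ` ?U) + sum R (odot [x] ` ?D)"
    by (simp add: H_eq_sum_R[of "x # \<gamma>"] up sum.union_disjoint finite_dle)
  also have "sum R (Cons x ` ?U) = (\<Sum>\<beta>\<in>?U. R (x # \<beta>))"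
    by (simp add: sum.reindex)
  also have "sum R (odot [x] ` ?D) = (\<Sum>\<beta>\<in>?D. R (odot [x] \<beta>))"
    by (subst sum.reindex) (auto intro: inj_on_subset[OF inj_on_odot])
  also have "\<dots> = (\<Sum>\<beta>\<in>?U. if odot_defined [x] \<beta> then R (odot [x] \<beta>) else 0)"
    by (simp add: sum.inter_filter[symmetric] finite_dle)
  finally have "H (x # \<gamma>) = sum T ?U"
    by (simp add: T_def sum.distrib)
  moreover have "H (x # \<gamma>) = (\<Sum>\<beta>\<in>?U. H [x] * R \<beta>)"
    using H_mult[of "[x]" \<gamma>] H_eq_sum_R[of \<gamma>] by (simp add: sum_distrib_left)
  moreover have "?U = insert \<gamma> {\<beta>. \<gamma> \<prec> \<beta>}" "\<gamma> \<notin> {\<beta>. \<gamma> \<prec> \<beta>}"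
    by (auto simp: dless_def)
  moreover have "(\<Sum>\<beta> | \<gamma> \<prec> \<beta>. H [x] * R \<beta>) = (\<Sum>\<beta> | \<gamma> \<prec> \<beta>. T \<beta>)"
    by (rule sum.cong) (auto simp: T_def dless_def less.IH dest!: dle_length)
  ultimately have "H [x] * R \<gamma> = T \<gamma>"
    by (simp add: finite_dle)
  then show ?case
    by (simp add: T_def)
qed

lemma R_Nil [simp]: "R [] = 1"
proof -
  have "{\<beta>. [] \<prec> \<beta>} = {}"
    by (auto simp: dless_def dest: dle_length)
  then show ?thesis
    by (simp only: R.simps[of "[]"] sum.empty H_Nil diff_zero)
qed

lemma R_Cons: "R (x # \<gamma>) = H [x] * R \<gamma> - (if odot_defined [x] \<gamma> then R (odot [x] \<gamma>) else 0)"
  by (simp add: H_single_mult_R)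

lemma length_odot_Cons: "odot_defined [x] \<gamma> \<Longrightarrow> length (odot [x] \<gamma>) = length \<gamma>"
  by (auto elim: odot_definedE)

text \<open>
  Induction on the length of \<open>\<beta>\<close>. For \<open>\<beta> = x # \<delta>\<close>, replace \<open>R \<beta>\<close> by
  \<open>H [x] * R \<delta> - R (odot [x] \<delta>)\<close>, or by \<open>H [x] * R \<delta>\<close> if \<open>odot [x] \<delta>\<close> is undefined. Both \<open>\<delta>\<close> and \<open>odot [x] \<delta>\<close> are shorter than \<open>\<beta>\<close>, and by
  associativity the terms in which \<open>x\<close> is absorbed into \<open>\<delta>\<close> cancel.
\<close>

lemma R_mult:
  "R \<beta> * R \<gamma> = R (\<beta> @ \<gamma>) + (if odot_defined \<beta> \<gamma> then R (odot \<beta> \<gamma>) else 0)"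
proof (induction \<beta> rule: measure_induct_rule[of length])
  case (less \<beta>)
  show ?case
  proof (cases \<beta>)
    case Nil
    then show ?thesis by simp
  next
    case (Cons x \<delta>)
    show ?thesis
    proof (cases "\<delta> = []")
      case True
      with Cons show ?thesis
        by (simp add: R_Cons[of x "[]"] H_single_mult_R)
    next
      case False
      let ?\<epsilon> = "odot [x] \<delta>"
      let ?r = "\<lambda>P \<alpha>. if P then R \<alpha> else 0"
      have IH: "R \<delta> * R \<gamma> = R (\<delta> @ \<gamma>) + ?r (odot_defined \<delta> \<gamma>) (odot \<delta> \<gamma>)"
        using Cons by (intro less.IH) simp
      have "?r (odot_defined [x] \<delta>) ?\<epsilon> * R \<gamma> = ?r (odot_defined [x] \<delta>) (?\<epsilon> @ \<gamma>) +
          ?r (odot_defined [x] \<delta> \<and> odot_defined ?\<epsilon> \<gamma>) (odot ?\<epsilon> \<gamma>)"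
        using Cons by (auto simp: less.IH length_odot_Cons)
      moreover have "H [x] * R (\<delta> @ \<gamma>) = R (\<beta> @ \<gamma>) + ?r (odot_defined [x] \<delta>) (?\<epsilon> @ \<gamma>)"
        using False Cons by (simp add: H_single_mult_R odot_append)
      moreover have "H [x] * ?r (odot_defined \<delta> \<gamma>) (odot \<delta> \<gamma>) =
          ?r (odot_defined \<beta> \<gamma>) (odot \<beta> \<gamma>) +
          ?r (odot_defined [x] \<delta> \<and> odot_defined ?\<epsilon> \<gamma>) (odot ?\<epsilon> \<gamma>)"
        using append_odot[OF False, of "[x]" \<gamma>] odot_assoc[OF False, where x = x and \<gamma> = \<gamma>] Cons
        by (auto simp: H_single_mult_R)
      moreover have "R \<beta> * R \<gamma> = H [x] * (R \<delta> * R \<gamma>) - ?r (odot_defined [x] \<delta>) ?\<epsilon> * R \<gamma>"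
        unfolding Cons R_Cons by (simp only: left_diff_distrib mult.assoc)
      ultimately show ?thesis
        by (simp only: IH distrib_left) simp
    qed
  qed
qed

lemma poly_mapping_induct [case_names single sum]:
  assumes single: "\<And>k v. P (Poly_Mapping.single k v)"
    and sum: "\<And>p q. P p \<Longrightarrow> P q \<Longrightarrow> P (p + q)"
  shows "P p"
proof (induction p rule: Poly_Mapping.update_induct)
  case const
  show ?case
    using single[of undefined 0] by simp
next
  case (update p k v)
  then have "Poly_Mapping.update k v p = Poly_Mapping.single k v + p"
    by (intro poly_mapping_eqI)
      (auto simp: lookup_update lookup_add lookup_single when_def in_keys_iff)
  with update single sum show ?case
    by simp
qed

lemma lookup_H_single_mult:
  "Poly_Mapping.lookup (H [x] * p) \<alpha> =
     (case \<alpha> of [] \<Rightarrow> 0 | y # \<beta> \<Rightarrow> if x = y then Poly_Mapping.lookup p \<beta> else 0)"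
proof (induction p rule: poly_mapping_induct)
  case (single k v)
  show ?case
    by (auto simp: H_eq_single mult_single plus_list_def lookup_single when_def split: list.splits)
next
  case (sum p q)
  then show ?case
    by (auto simp: distrib_left lookup_add split: list.splits)
qed

text \<open>
  The recursion for \<open>R (x # \<delta>)\<close> has two terms. The first contributes to the \<open>\<alpha>\<close> that keep \<open>x\<close> in
  front, the second to the \<open>\<alpha>\<close> that lie above \<open>odot [x] \<delta>\<close>. These \<open>\<alpha>\<close> are disjoint and exhaust
  the up-set of \<open>x # \<delta>\<close>; the sign changes because \<open>odot [x] \<delta>\<close> is one entry shorter.
\<close>

lemma lookup_R:
  "Poly_Mapping.lookup (R \<gamma>) \<alpha> = (if \<gamma> \<preceq> \<alpha> then (-1) ^ (length \<gamma> + length \<alpha>) else 0)"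
proof (induction \<gamma> arbitrary: \<alpha> rule: measure_induct_rule[of length])
  case (less \<gamma>)
  show ?case
  proof (cases \<gamma>)
    case Nil
    then show ?thesis
      by (auto simp: H_eq_single lookup_single when_def simp flip: H_Nil dest: dle_length)
  next
    case (Cons x \<delta>)
    have IH: "Poly_Mapping.lookup (R \<delta>) \<beta> = (if \<delta> \<preceq> \<beta> then (-1) ^ (length \<delta> + length \<beta>) else 0)" for \<beta>
      using Cons by (intro less.IH) simp
    have IH': "Poly_Mapping.lookup (R (odot [x] \<delta>)) \<beta> =
        (if odot [x] \<delta> \<preceq> \<beta> then (-1) ^ (length \<delta> + length \<beta>) else 0)"
      if "odot_defined [x] \<delta>" for \<beta>
      using Cons that by (simp add: less.IH length_odot_Cons)
    show ?thesis
      unfolding Cons R_Cons lookup_minus lookup_H_single_mult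
      by (auto simp: IH IH' dle_Cons_iff_initial[of x \<delta>] odot_not_dle_Cons split: list.splits)
  qed
qed

section \<open>The dual bases\<close>

lemma pairing_linear:
  "pairing f (x + y) = pairing f x + pairing f y" "pairing f (qscale c x) = c * pairing f x"
  using pairing[of f] by (auto simp: linear_qscale_iff)

lemma pairing_sqsym [simp]:
  "pairing 0 x = 0" "pairing (f + g) x = pairing f x + pairing g x"
  "pairing (scale_sqsym c f) x = c * pairing f x"
  by (simp_all add: zero_sqsym.rep_eq plus_sqsym.rep_eq scale_sqsym.rep_eq)

lemma pairing_zero_right [simp]: "pairing f 0 = 0"
  using pairing_linear(1)[of f 0 0] by simp

lemma pairing_minus_right: "pairing f (x - y) = pairing f x - pairing f y"
  using pairing_linear(1)[of f "x - y" y] by simp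

lemma pairing_sum_right: "pairing f (sum g A) = (\<Sum>a\<in>A. pairing f (g a))"
  by (induction A rule: infinite_finite_induct) (auto simp: pairing_linear)

lemma pairing_sum_left: "pairing (sum g A) x = (\<Sum>a\<in>A. pairing (g a) x)"
  by (induction A rule: infinite_finite_induct) auto

lemma snsym_induct [case_names H add scale]:
  assumes "\<And>\<alpha>. P (H \<alpha>)" "\<And>x y. P x \<Longrightarrow> P y \<Longrightarrow> P (x + y)" "\<And>c x. P x \<Longrightarrow> P (qscale c x)"
  shows "P x"
proof (induction x rule: poly_mapping_induct)
  case (single k v)
  have "Poly_Mapping.single k v = qscale v (H k)"
    by (rule poly_mapping_eqI) (simp add: H_eq_single lookup_single when_def)
  with assms show ?case
    by simp
qed (rule assms)

lemma snsym_induct_R [case_names R add scale]: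
  assumes R: "\<And>\<alpha>. P (R \<alpha>)" and add: "\<And>x y. P x \<Longrightarrow> P y \<Longrightarrow> P (x + y)"
    and scale: "\<And>c x. P x \<Longrightarrow> P (qscale c x)"
  shows "P x"
proof (induction x rule: snsym_induct)
  case (H \<alpha>)
  have "P 0"
    using scale[OF R, of 0] by simp
  then have "P (\<Sum>\<beta>\<in>A. R \<beta>)" for A
    by (induction A rule: infinite_finite_induct) (auto intro: add R)
  then show ?case
    by (simp add: H_eq_sum_R)
qed (use assms in auto)

lemma sqsym_eqI_H:
  assumes "\<And>\<beta>. pairing f (H \<beta>) = pairing g (H \<beta>)"
  shows "f = g"
proof -
  have "pairing f x = pairing g x" for x
    by (induction x rule: snsym_induct) (use assms in \<open>auto simp: pairing_linear\<close>)
  then show ?thesis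
    by (auto simp flip: pairing_inject)
qed

lemma sqsym_eqI_R:
  assumes "\<And>\<beta>. pairing f (R \<beta>) = pairing g (R \<beta>)"
  shows "f = g"
  by (rule sqsym_eqI_H) (use assms in \<open>simp add: H_eq_sum_R pairing_sum_right\<close>)

text \<open>
  The definite description is harmless as soon as functionals are determined by their values on
  \<open>B\<close>; a functional with the prescribed values then is the dual basis element.
\<close>

lemma dual_basis_eqI:
  assumes "\<And>f g. (\<And>\<beta>. pairing f (B \<beta>) = pairing g (B \<beta>)) \<Longrightarrow> f = g"
    and "\<And>\<beta>. pairing f (B \<beta>) = (if \<alpha> = \<beta> then 1 else 0)"
  shows "dual_basis B \<alpha> = f"
  unfolding dual_basis_def by (rule the_equality) (use assms in auto)

lemma pairing_M: "pairing (M \<alpha>) x = Poly_Mapping.lookup x \<alpha>"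
proof -
  let ?c = "\<lambda>x :: snsym. Poly_Mapping.lookup x \<alpha>"
  have "?c x = 0" if "x \<in> snsym_component n" "n \<noteq> degree \<alpha>" for x n
    using that(1) unfolding snsym_component_def
    by (induction rule: qvs.span_induct_alt)
      (use that(2) in \<open>auto simp: lookup_add H_eq_single lookup_single\<close>)
  then have "{n. \<exists>x\<in>snsym_component n. ?c x \<noteq> 0} \<subseteq> {degree \<alpha>}"
    by auto
  then have "finite {n. \<exists>x\<in>snsym_component n. ?c x \<noteq> 0}"
    by (rule finite_subset) simp
  moreover have "Vector_Spaces.linear qscale (*) ?c"
    by (simp add: linear_qscale_iff lookup_add)
  ultimately have c: "pairing (Abs_sqsym ?c) = ?c"
    by (intro Abs_sqsym_inverse) simp
  have "M \<alpha> = Abs_sqsym ?c"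
    unfolding M_def
    by (rule dual_basis_eqI) (auto intro: sqsym_eqI_H simp: c H_eq_single lookup_single when_def)
  then show ?thesis
    by (simp add: c)
qed

lemma pairing_M_H: "pairing (M \<alpha>) (H \<beta>) = (if \<alpha> = \<beta> then 1 else 0)"
  by (auto simp: pairing_M H_eq_single lookup_single when_def)

text \<open>
  On \<open>H \<gamma>\<close> the sum is the indicator of \<open>\<gamma> \<preceq> \<alpha>\<close>. Subtracting the values on the \<open>R \<beta>\<close> with
  \<open>\<gamma> \<prec> \<beta>\<close>, known by induction, leaves the indicator of \<open>\<gamma> = \<alpha>\<close>.
\<close>

lemma pairing_sum_M_R:
  "pairing (\<Sum>\<beta> | \<beta> \<preceq> \<alpha>. M \<beta>) (R \<gamma>) = (if \<alpha> = \<gamma> then 1 else 0)"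
proof (induction \<gamma> rule: measure_induct_rule[of length])
  case (less \<gamma>)
  let ?f = "\<Sum>\<beta> | \<beta> \<preceq> \<alpha>. M \<beta>"
  have H: "pairing ?f (H \<gamma>) = (if \<gamma> \<preceq> \<alpha> then 1 else 0)"
    by (simp add: pairing_sum_left pairing_M_H finite_dle)
  have "(\<Sum>\<beta> | \<gamma> \<prec> \<beta>. pairing ?f (R \<beta>)) = (\<Sum>\<beta> | \<gamma> \<prec> \<beta>. if \<alpha> = \<beta> then 1 else 0)"
    by (rule sum.cong[OF refl], rule less.IH) (auto simp: dless_def dest: dle_length)
  also have "\<dots> = (if \<gamma> \<prec> \<alpha> then 1 else 0)"
    by (simp add: finite_dle)
  finally show ?case
    by (simp only: R.simps[of \<gamma>] pairing_minus_right pairing_sum_right H) (auto simp: dless_def)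
qed

lemma L_eq_sum_M: "L \<alpha> = (\<Sum>\<beta> | \<beta> \<preceq> \<alpha>. M \<beta>)"
  unfolding L_def by (intro dual_basis_eqI) (auto intro: sqsym_eqI_R simp: pairing_sum_M_R)

lemma pairing_L_R: "pairing (L \<alpha>) (R \<beta>) = (if \<alpha> = \<beta> then 1 else 0)"
  by (simp add: L_eq_sum_M pairing_sum_M_R)

lemma minus_one_powi_diff: "(-1 :: rat) powi (int m - int n) = (-1) ^ (m + n)"
  by (simp add: power_int_diff power_add) (simp add: minus_one_power_iff)

lemma M_eq_sum_L:
  "M \<alpha> = (\<Sum>\<beta> | \<beta> \<preceq> \<alpha>. scale_sqsym ((-1) powi (int (length \<alpha>) - int (length \<beta>))) (L \<beta>))"
proof (rule sqsym_eqI_R)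
  fix \<gamma>
  have "pairing (\<Sum>\<beta> | \<beta> \<preceq> \<alpha>. scale_sqsym ((-1) powi (int (length \<alpha>) - int (length \<beta>))) (L \<beta>)) (R \<gamma>)
      = (\<Sum>\<beta> | \<beta> \<preceq> \<alpha>. if \<beta> = \<gamma> then (-1) ^ (length \<alpha> + length \<gamma>) else 0)"
    by (auto simp: pairing_sum_left pairing_L_R minus_one_powi_diff intro!: sum.cong)
  also have "\<dots> = pairing (M \<alpha>) (R \<gamma>)"
    by (simp add: finite_dle pairing_M lookup_R add.commute)
  finally show "pairing (M \<alpha>) (R \<gamma>) = pairing
      (\<Sum>\<beta> | \<beta> \<preceq> \<alpha>. scale_sqsym ((-1) powi (int (length \<alpha>) - int (length \<beta>))) (L \<beta>)) (R \<gamma>)"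
    by simp
qed

section \<open>The tensor square\<close>

lemma tensor_add_left: "(f + f') \<otimes> g = f \<otimes> g + f' \<otimes> g"
proof transfer
  fix f f' g
  have "pure (f + f') g - pure f g - pure f' g \<in> tensor_relators"
    unfolding tensor_relators_def by blast
  then show "tensor_eq (pure (f + f') g) (pure f g + pure f' g)"
    by (simp add: tensor_eq_def qvs.span_base diff_diff_eq)
qed

lemma tensor_add_right: "f \<otimes> (g + g') = f \<otimes> g + f \<otimes> g'"
proof transfer
  fix f g g'
  have "pure f (g + g') - pure f g - pure f g' \<in> tensor_relators"
    unfolding tensor_relators_def by blast
  then show "tensor_eq (pure f (g + g')) (pure f g + pure f g')"
    by (simp add: tensor_eq_def qvs.span_base diff_diff_eq)
qed

lemma tensor_scale: "scale_sqsym c f \<otimes> g = f \<otimes> scale_sqsym c g"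
proof -
  have "pure (scale_sqsym c f) g - qscale c (pure f g) \<in> tensor_relators"
    "pure f (scale_sqsym c g) - qscale c (pure f g) \<in> tensor_relators"
    unfolding tensor_relators_def by blast+
  from this[THEN qvs.span_base] have "pure (scale_sqsym c f) g - qscale c (pure f g) -
      (pure f (scale_sqsym c g) - qscale c (pure f g)) \<in> qvs.span tensor_relators"
    by (rule qvs.span_diff)
  then show ?thesis
    by (simp add: tensor.abs_eq sqsym2.abs_eq_iff tensor_eq_def)
qed

lemma tensor_zero [simp]: "0 \<otimes> g = 0" "f \<otimes> 0 = 0"
  using tensor_add_left[of 0 0 g] tensor_add_right[of f 0 0] by simp_all

lemma tensor_sum_right: "f \<otimes> sum g A = (\<Sum>a\<in>A. f \<otimes> g a)"
  by (induction A rule: infinite_finite_induct) (auto simp: tensor_add_right)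

lemma sqsym2_induct [case_names tensor add]:
  assumes tensor: "\<And>f g. P (f \<otimes> g)" and add: "\<And>s t. P s \<Longrightarrow> P t \<Longrightarrow> P (s + t)"
  shows "P t"
proof -
  have "P (abs_sqsym2 p)" for p
  proof (induction p rule: poly_mapping_induct)
    case (single k v)
    obtain f g where k: "k = (f, g)"
      by fastforce
    have "pure (scale_sqsym v f) g - qscale v (pure f g) \<in> tensor_relators"
      unfolding tensor_relators_def by blast
    moreover have "qscale v (pure f g) = Poly_Mapping.single k v"
      by (rule poly_mapping_eqI) (simp add: k lookup_single when_def)
    ultimately have "abs_sqsym2 (Poly_Mapping.single k v) = scale_sqsym v f \<otimes> g"
      by (metis qvs.span_base sqsym2.abs_eq_iff tensor.abs_eq tensor_eq_def)
    then show ?case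
      by (simp add: tensor)
  next
    case (sum p q)
    then show ?case
      using add by (simp flip: plus_sqsym2.abs_eq)
  qed
  then show ?thesis
    by (metis Quotient_abs_rep[OF Quotient_sqsym2])
qed

lemma pairing2_add: "pairing2 (s + t) x y = pairing2 s x y + pairing2 t x y"
  by transfer (simp add: pre_pairing2_add)

lemma pairing2_zero: "pairing2 0 x y = 0"
  using pairing2_add[of 0 0 x y] by simp

lemma pairing2_diff: "pairing2 (s - t) x y = pairing2 s x y - pairing2 t x y"
  using pairing2_add[of "s - t" t x y] by simp

lemma pairing2_sum: "pairing2 (sum t A) x y = (\<Sum>a\<in>A. pairing2 (t a) x y)"
  by (induction A rule: infinite_finite_induct) (auto simp: pairing2_add pairing2_zero)

lemma pairing2_linear:
  "pairing2 t (x + x') y = pairing2 t x y + pairing2 t x' y"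
  "pairing2 t x (y + y') = pairing2 t x y + pairing2 t x y'"
  "pairing2 t (qscale c x) y = c * pairing2 t x y"
  "pairing2 t x (qscale c y) = c * pairing2 t x y"
  by (induction t rule: sqsym2_induct; simp add: pairing2_add pairing2_tensor pairing_linear algebra_simps)+

text \<open>
  The functional lives in finitely many degrees, and each degree contains only finitely many
  compositions.
\<close>

lemma finite_support_H: "finite {\<alpha>. pairing f (H \<alpha>) \<noteq> 0}"
proof -
  let ?N = "{n. \<exists>x\<in>snsym_component n. pairing f x \<noteq> 0}"
  have "H \<alpha> \<in> snsym_component (degree \<alpha>)" for \<alpha>
    unfolding snsym_component_def by (rule qvs.span_base) blast
  then have "{\<alpha>. pairing f (H \<alpha>) \<noteq> 0} \<subseteq> (\<Union>n\<in>?N. {\<alpha>. degree \<alpha> = n})"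
    by blast
  moreover have "finite ?N"
    using pairing[of f] by simp
  ultimately show ?thesis
    using finite_degree by (meson finite_UN_I finite_subset)
qed

lemma sqsym_expand_M:
  "f = (\<Sum>\<alpha> | pairing f (H \<alpha>) \<noteq> 0. scale_sqsym (pairing f (H \<alpha>)) (M \<alpha>))"
proof (rule sqsym_eqI_H)
  fix \<beta>
  have "(\<Sum>\<alpha> | pairing f (H \<alpha>) \<noteq> 0. pairing f (H \<alpha>) * (if \<alpha> = \<beta> then 1 else 0)) =
      (\<Sum>\<alpha> | pairing f (H \<alpha>) \<noteq> 0. if \<alpha> = \<beta> then pairing f (H \<beta>) else 0)"
    by (rule sum.cong) auto
  then show "pairing f (H \<beta>) =
      pairing (\<Sum>\<alpha> | pairing f (H \<alpha>) \<noteq> 0. scale_sqsym (pairing f (H \<alpha>)) (M \<alpha>)) (H \<beta>)"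
    by (simp add: pairing_sum_left pairing_M_H finite_support_H)
qed

text \<open>
  The coefficient family vanishes outside \<open>A\<close> so that two such expansions can be added over the
  union of their index sets.
\<close>

lemma sqsym2_expand_M:
  "\<exists>A g. finite A \<and> (\<forall>\<gamma>. \<gamma> \<notin> A \<longrightarrow> g \<gamma> = 0) \<and> t = (\<Sum>\<gamma>\<in>A. g \<gamma> \<otimes> M \<gamma>)"
proof (induction t rule: sqsym2_induct)
  case (tensor f h)
  have "f \<otimes> h = (\<Sum>\<gamma> | pairing h (H \<gamma>) \<noteq> 0. scale_sqsym (pairing h (H \<gamma>)) f \<otimes> M \<gamma>)"
    by (subst sqsym_expand_M[of h]) (simp add: tensor_sum_right tensor_scale)
  moreover have "scale_sqsym 0 f = 0"
    by transfer simp
  ultimately show ?case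
    using finite_support_H[of h]
    by (intro exI[of _ "{\<gamma>. pairing h (H \<gamma>) \<noteq> 0}"] exI[of _ "\<lambda>\<gamma>. scale_sqsym (pairing h (H \<gamma>)) f"])
      simp
next
  case (add s t)
  then obtain A g B h where *: "finite A" "\<forall>\<gamma>. \<gamma> \<notin> A \<longrightarrow> g \<gamma> = 0" "s = (\<Sum>\<gamma>\<in>A. g \<gamma> \<otimes> M \<gamma>)"
    "finite B" "\<forall>\<gamma>. \<gamma> \<notin> B \<longrightarrow> h \<gamma> = 0" "t = (\<Sum>\<gamma>\<in>B. h \<gamma> \<otimes> M \<gamma>)"
    by blast
  have "s = (\<Sum>\<gamma>\<in>A \<union> B. g \<gamma> \<otimes> M \<gamma>)" "t = (\<Sum>\<gamma>\<in>A \<union> B. h \<gamma> \<otimes> M \<gamma>)"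
    unfolding *(3,6) using * by (intro sum.mono_neutral_left; force)+
  then have "s + t = (\<Sum>\<gamma>\<in>A \<union> B. (g \<gamma> + h \<gamma>) \<otimes> M \<gamma>)"
    by (simp add: sum.distrib tensor_add_left)
  with * show ?case
    by (intro exI[of _ "A \<union> B"] exI[of _ "\<lambda>\<gamma>. g \<gamma> + h \<gamma>"]) simp
qed

text \<open>
  In the expansion of \<open>s - t\<close>, pairing with \<open>x\<close> and \<open>H \<gamma>\<close> gives the value of the coefficient
  \<open>g \<gamma>\<close> at \<open>x\<close>; so all coefficients vanish.
\<close>

lemma sqsym2_eqI:
  assumes "\<And>x y. pairing2 s x y = pairing2 t x y"
  shows "s = t"
proof -
  obtain A g where A: "finite A" "s - t = (\<Sum>\<gamma>\<in>A. g \<gamma> \<otimes> M \<gamma>)"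
    using sqsym2_expand_M by blast
  have "g \<gamma> = 0" if "\<gamma> \<in> A" for \<gamma>
  proof (rule sqsym_eqI_H)
    fix \<beta>
    have "(\<Sum>\<delta>\<in>A. pairing (g \<delta>) (H \<beta>) * (if \<delta> = \<gamma> then 1 else 0)) =
        (\<Sum>\<delta>\<in>A. if \<delta> = \<gamma> then pairing (g \<gamma>) (H \<beta>) else 0)"
      by (rule sum.cong) auto
    then have "pairing2 (s - t) (H \<beta>) (H \<gamma>) = pairing (g \<gamma>) (H \<beta>)"
      using A that by (simp add: pairing2_sum pairing2_tensor pairing_M_H)
    then show "pairing (g \<gamma>) (H \<beta>) = pairing 0 (H \<beta>)"
      by (simp add: pairing2_diff assms)
  qed
  then show ?thesis
    using A by simp
qed

section \<open>The coproduct\<close>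

text \<open>
  Both sides of the condition defining the coproduct are bilinear, so it suffices to verify it on
  the ribbon functions, where the product is known.
\<close>

lemma coproduct_eqI:
  assumes "\<And>\<beta> \<gamma>. pairing2 t (R \<beta>) (R \<gamma>) = pairing f (R \<beta> * R \<gamma>)"
  shows "coproduct f = t"
proof -
  \<comment> \<open>scalars are multiples of the unit of the monoid algebra and are central\<close>
  have scale: "qscale c x * y = qscale c (x * y)" "x * qscale c y = qscale c (x * y)"
    for c and x y :: snsym
  proof -
    have c: "qscale c z = Poly_Mapping.single 0 c * z" "qscale c z = z * Poly_Mapping.single 0 c"
      for z :: snsym
    proof -
      show "qscale c z = Poly_Mapping.single 0 c * z"
        by (induction z rule: poly_mapping_induct)
          (auto simp: mult_single distrib_left qvs.scale_right_distrib lookup_single when_def intro!: poly_mapping_eqI)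
      show "qscale c z = z * Poly_Mapping.single 0 c"
        by (induction z rule: poly_mapping_induct)
          (auto simp: mult_single distrib_right qvs.scale_right_distrib lookup_single when_def intro!: poly_mapping_eqI)
    qed
    show "qscale c x * y = qscale c (x * y)"
      by (simp add: c(1) mult.assoc)
    show "x * qscale c y = qscale c (x * y)"
      by (simp add: c(2) mult.assoc)
  qed
  have "pairing2 t (R \<beta>) y = pairing f (R \<beta> * y)" for \<beta> y
    by (induction y rule: snsym_induct_R)
      (simp_all add: assms pairing2_linear pairing_linear distrib_left scale)
  then have "pairing2 t x y = pairing f (x * y)" for x y
    by (induction x rule: snsym_induct_R)
      (simp_all add: pairing2_linear pairing_linear distrib_right scale)
  then show ?thesis
    unfolding coproduct_def by (intro the_equality) (auto intro: sqsym2_eqI)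
qed

lemma finite_factorisations:
  "finite {(\<beta>, \<gamma>). \<beta> @ \<gamma> = \<alpha> \<or> odot_defined \<beta> \<gamma> \<and> odot \<beta> \<gamma> = \<alpha>}"
proof (rule finite_subset)
  have "{\<beta>. degree \<beta> \<le> degree \<alpha>} = (\<Union>n\<le>degree \<alpha>. {\<beta>. degree \<beta> = n})"
    by auto
  then have "finite {\<beta>. degree \<beta> \<le> degree \<alpha>}"
    by (simp add: finite_degree)
  then show "finite ({\<beta>. degree \<beta> \<le> degree \<alpha>} \<times> {\<beta>. degree \<beta> \<le> degree \<alpha>})"
    by simp
  show "{(\<beta>, \<gamma>). \<beta> @ \<gamma> = \<alpha> \<or> odot_defined \<beta> \<gamma> \<and> odot \<beta> \<gamma> = \<alpha>} \<subseteq>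
      {\<beta>. degree \<beta> \<le> degree \<alpha>} \<times> {\<beta>. degree \<beta> \<le> degree \<alpha>}"
    by (auto simp: degree_append degree_odot)
qed

text \<open>
  Hence the two products in the product rule are distinct, and a pair contributes at most once to
  the coproduct.
\<close>

lemma odot_neq_append: "odot_defined \<beta> \<gamma> \<Longrightarrow> odot \<beta> \<gamma> \<noteq> \<beta> @ \<gamma>"
proof
  assume d: "odot_defined \<beta> \<gamma>" and "odot \<beta> \<gamma> = \<beta> @ \<gamma>"
  then have "length (odot \<beta> \<gamma>) = length \<beta> + length \<gamma>"
    by simp
  with d show False
    by (auto simp: odot_defined_def odot_def neq_Nil_conv)
qed

lemma coproduct_L:
  "coproduct (L \<alpha>) =
    (\<Sum>(\<beta>, \<gamma>) \<in> {(\<beta>, \<gamma>). \<beta> @ \<gamma> = \<alpha> \<or> odot_defined \<beta> \<gamma> \<and> odot \<beta> \<gamma> = \<alpha>}. L \<beta> \<otimes> L \<gamma>)"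
  (is "_ = sum _ ?S")
proof (rule coproduct_eqI)
  fix \<beta> \<gamma>
  have "pairing2 (\<Sum>(\<beta>, \<gamma>)\<in>?S. L \<beta> \<otimes> L \<gamma>) (R \<beta>) (R \<gamma>) =
      (\<Sum>p\<in>?S. if p = (\<beta>, \<gamma>) then 1 else 0)"
    by (auto simp: pairing2_sum pairing2_tensor pairing_L_R intro!: sum.cong)
  also have "\<dots> = (if (\<beta>, \<gamma>) \<in> ?S then 1 else 0)"
    using finite_factorisations by simp
  also have "\<dots> = pairing (L \<alpha>) (R \<beta> * R \<gamma>)"
    using odot_neq_append[of \<beta> \<gamma>] by (auto simp: R_mult pairing_linear pairing_L_R)
  finally show "pairing2 (\<Sum>(\<beta>, \<gamma>)\<in>?S. L \<beta> \<otimes> L \<gamma>) (R \<beta>) (R \<gamma>) = pairing (L \<alpha>) (R \<beta> * R \<gamma>)" .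
qed

theorem theorem7p2:
  fixes \<alpha> :: dcomp
  shows "L \<alpha> = (\<Sum>\<beta> | \<beta> \<preceq> \<alpha>. M \<beta>) \<and>
    M \<alpha> = (\<Sum>\<beta> | \<beta> \<preceq> \<alpha>.
      scale_sqsym ((-1) powi (int (length \<alpha>) - int (length \<beta>))) (L \<beta>)) \<and>
    coproduct (L \<alpha>) =
      (\<Sum>(\<beta>, \<gamma>) \<in> {(\<beta>, \<gamma>). \<beta> @ \<gamma> = \<alpha> \<or> odot_defined \<beta> \<gamma> \<and> odot \<beta> \<gamma> = \<alpha>}. L \<beta> \<otimes> L \<gamma>)"
  using L_eq_sum_M M_eq_sum_L coproduct_L by blast

end
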